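(* For any bounded lattice $L$ and binary operation $\to$ on $L$, the following are equivalent: 1. $\to$ is a Heyting implication, i.e., for all $a,b,c\in L$, $a\wedge b\leq c$ iff $a\leq b\to c$; 2. $\to$ is a preconditional satisfying modus ponens and weak monotonicity; 3. $\to$ satisfies modus ponens, weak monotonicity, and, for all $a,b,c\in L$, both $a\to b\leq a\to(a\wedge b)$ and $a\to(b\wedge c)\leq a\to b$.
   Context: A preconditional on a bounded lattice $L$ is a binary operation $\to$ on $L$ such that for all $a,b,c\in L$: (1) $1\to a\leq a$; (2) $a\wedge b\leq a\to b$; (3) $a\to b\leq a\to(a\wedge b)$; (4) $a\to(b\wedge c)\leq a\to b$; (5) $a\to((a\wedge b)\to c)\leq (a\wedge b)\to c$. Modus ponens: $a\wedge(a\to b)\leq b$ for all $a,b\in L$. Weak monotonicity: $b\leq a\to b$ for all $a,b\in L$. *)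

theory Defs
  imports Main
begin

definition preconditional :: "('a::bounded_lattice \<Rightarrow> 'a \<Rightarrow> 'a) \<Rightarrow> bool" where
  "preconditional imp \<longleftrightarrow>
     (\<forall>a. imp top a \<le> a) \<and>
     (\<forall>a b. inf a b \<le> imp a b) \<and>
     (\<forall>a b. imp a b \<le> imp a (inf a b)) \<and>
     (\<forall>a b c. imp a (inf b c) \<le> imp a b) \<and>
     (\<forall>a b c. imp a (imp (inf a b) c) \<le> imp (inf a b) c)"

definition modus_ponens :: "('a::bounded_lattice \<Rightarrow> 'a \<Rightarrow> 'a) \<Rightarrow> bool" where
  "modus_ponens imp \<longleftrightarrow> (\<forall>a b. inf a (imp a b) \<le> b)"

definition weak_monotonicity :: "('a::bounded_lattice \<Rightarrow> 'a \<Rightarrow> 'a) \<Rightarrow> bool" where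
  "weak_monotonicity imp \<longleftrightarrow> (\<forall>a b. b \<le> imp a b)"

definition heyting_implication :: "('a::bounded_lattice \<Rightarrow> 'a \<Rightarrow> 'a) \<Rightarrow> bool" where
  "heyting_implication imp \<longleftrightarrow> (\<forall>a b c. inf a b \<le> c \<longleftrightarrow> a \<le> imp b c)"

end

theory Submission
  imports Defs
begin

text \<open>A Heyting implication is a right adjoint: \<open>imp b\<close> is adjoint to meeting
  with b. Modus ponens is the counit of this adjunction, and weak monotonicity follows since a meet
  lies below its factors. The preconditional laws reduce to meet inequalities
  (\<open>heyting_implication_preconditional\<close>). Conversely, if inf a b \<le> c, the chain a
  \<le> imp b a \<le> imp b (inf b a) \<le> imp b c recovers the adjunction
  (\<open>heyting_implicationI\<close>).\<close>

lemma heyting_implication_modus_ponens: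
  assumes "heyting_implication imp"
  shows "modus_ponens imp"
  using assms unfolding heyting_implication_def modus_ponens_def
  by (metis inf.commute order.refl)

lemma heyting_implication_weak_monotonicity:
  assumes "heyting_implication imp"
  shows "weak_monotonicity imp"
  using assms unfolding heyting_implication_def weak_monotonicity_def
  by (metis inf.cobounded1)

text \<open>Adjunction moves each antecedent to the left as a meet; modus ponens then removes any
  implication found there.\<close>

lemma heyting_implication_preconditional:
  fixes imp :: "'a::bounded_lattice \<Rightarrow> 'a \<Rightarrow> 'a"
  assumes "heyting_implication imp"
  shows "preconditional imp"
proof -
  have adj: "x \<le> imp y z \<longleftrightarrow> inf x y \<le> z" for x y z
    using assms unfolding heyting_implication_def by blast
  have mp: "inf (imp y z) y \<le> z" for y z
    using adj by blast
  show ?thesis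
    unfolding preconditional_def
  proof (intro conjI allI)
    fix a b c :: 'a
    show "imp top a \<le> a"
      using mp[of top a] by simp
    show "inf a b \<le> imp a b"
      unfolding adj by (simp add: le_infI1)
    show "imp a b \<le> imp a (inf a b)"
      unfolding adj using mp by simp
    show "imp a (inf b c) \<le> imp a b"
      unfolding adj using mp[of a "inf b c"] by simp
    let ?x = "imp a (imp (inf a b) c)"
    \<comment> \<open>Modus ponens is used twice: inf a b lies below a, which releases the inner
      implication, and is kept as a factor to discharge that one too.\<close>
    have "inf ?x (inf a b) \<le> inf (imp (inf a b) c) (inf a b)"
      using mp[of a "imp (inf a b) c"]
      by (meson inf.cobounded1 inf.cobounded2 inf_mono le_infI order.refl order.trans)
    also have "\<dots> \<le> c" by (rule mp)
    finally show "?x \<le> imp (inf a b) c" unfolding adj .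
  qed
qed

text \<open>Monotonicity of \<open>imp b\<close> in its second argument is not assumed;
  \<open>absorb\<close> and \<open>weaken\<close> supply as much of it as the adjunction
  needs.\<close>

lemma heyting_implicationI:
  fixes imp :: "'a::bounded_lattice \<Rightarrow> 'a \<Rightarrow> 'a"
  assumes "modus_ponens imp" and "weak_monotonicity imp"
    and absorb: "\<And>a b. imp a b \<le> imp a (inf a b)"
    and weaken: "\<And>a b c. imp a (inf b c) \<le> imp a b"
  shows "heyting_implication imp"
  unfolding heyting_implication_def
proof (intro allI iffI)
  fix a b c :: 'a
  assume le: "inf a b \<le> c"
  have "a \<le> imp b a"
    using assms(2) unfolding weak_monotonicity_def by blast
  also have "\<dots> \<le> imp b (inf b a)" by (rule absorb)
  \<comment> \<open>The hypothesis inf a b \<le> c enters here: c becomes a meet factor of the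
    consequent, the form that \<open>weaken\<close> can cut down to c.\<close>
  also have "inf b a = inf c (inf a b)"
    using le by (simp add: inf.absorb2 inf.commute)
  also have "imp b \<dots> \<le> imp b c" by (rule weaken)
  finally show "a \<le> imp b c" .
next
  fix a b c :: 'a
  assume "a \<le> imp b c"
  then have "inf a b \<le> inf b (imp b c)"
    by (simp add: le_infI1)
  also have "\<dots> \<le> c"
    using assms(1) unfolding modus_ponens_def by blast
  finally show "inf a b \<le> c" .
qed

theorem proposition3:
  fixes imp :: "'a::bounded_lattice \<Rightarrow> 'a \<Rightarrow> 'a"
  shows "(heyting_implication imp \<longleftrightarrow>
            preconditional imp \<and> modus_ponens imp \<and> weak_monotonicity imp) \<and>
         (preconditional imp \<and> modus_ponens imp \<and> weak_monotonicity imp \<longleftrightarrow>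
            modus_ponens imp \<and> weak_monotonicity imp \<and>
            (\<forall>a b c. imp a b \<le> imp a (inf a b) \<and> imp a (inf b c) \<le> imp a b))"
proof -
  \<comment> \<open>These two laws are the premises \<open>absorb\<close> and \<open>weaken\<close>
    of \<open>heyting_implicationI\<close>, so the three conditions form a cycle.\<close>
  have "preconditional imp \<Longrightarrow>
      \<forall>a b c. imp a b \<le> imp a (inf a b) \<and> imp a (inf b c) \<le> imp a b"
    unfolding preconditional_def by blast
  then show ?thesis
    using heyting_implication_preconditional heyting_implication_modus_ponens
      heyting_implication_weak_monotonicity heyting_implicationI
    by metis
qed

end
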